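(* Let $r\ge 2$, $\alpha_1,\dots,\alpha_r\in\mathbb{N}=\{1,2,\dots\}$, $p_2,\dots,p_r\in\mathbb{N}_0=\{0,1,2,\dots\}$, and $\mathbf{n}=(n_1,\dots,n_r)$ with $n_1,\dots,n_{r-1}\in\mathbb{N}_0$ and $n_r\in\mathbb{N}$. Consider the $r$-colour urn with $r\times r$ transition matrix $M=(M_{i,j})$ given by $M_{i,i}=-\alpha_i$ for $1\le i\le r$, $M_{i,i-1}=p_i\alpha_{i-1}$ for $2\le i\le r$, and $M_{i,j}=0$ otherwise, started with $n_i$ units of type $i$ for $i=1,\dots,r$. Let $\mathbf{X}_{\mathbf{n}}=(X_{\mathbf{n}}^{[1]},\dots,X_{\mathbf{n}}^{[r-1]})$ be the random vector of the numbers of units of type $1,\dots,r-1$ present at the moment when all units of type $r$ have been removed. Then the probability generating function $h_{\mathbf{n}}(\mathbf{v})=\mathbb{E}\big(\prod_{\ell=1}^{r-1}v_\ell^{X_{\mathbf{n}}^{[\ell]}}\big)$ is given by $$h_{\mathbf{n}}(\mathbf{v})=\int_{0}^{\infty}\big(g_{r}(t,\mathbf{v})\big)^{n_r-1}\,v_{r-1}^{p_r}\,\alpha_r\,n_r\,e^{-\alpha_r t}\prod_{\ell=1}^{r-1}\big(f_\ell(t,\mathbf{v})\big)^{n_\ell}\,dt,$$ where the functions $f_j$ are defined by $f_0(t,\mathbf{v})=1$ and $$f_j(t,\mathbf{v})=v_je^{-\alpha_j t}+\int_{0}^{t}\alpha_j e^{-\alpha_j u}\big(f_{j-1}(t-u,\mathbf{v})\big)^{p_j}\,du,\qquad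 j\ge 1,$$ and $g_j(t,\mathbf{v})=f_j(t,\mathbf{v})-v_je^{-\alpha_j t}$. (For $j=1$ the value of $p_1$ is irrelevant because $f_0=1$; and $g_r$ does not depend on $v_r$.)
   Context: Urn model: balls have $r$ types (colours). At each discrete step a ball is drawn uniformly at random, its type $i$ is inspected, and it is put back; then $M_{i,j}$ balls of type $j$ are added for each $j$ (a negative number meaning removal). Type-$i$ balls are counted in units of $\alpha_i$, i.e. $n_i$ units of type $i$ means $\alpha_i n_i$ balls of type $i$. Equivalently, from the state $(n_1,\dots,n_r)$ with $n_r\ge1$, type $i$ is selected with probability $\frac{\alpha_i n_i}{\alpha_1n_1+\dots+\alpha_rn_r}$; then $n_i$ is decreased by $1$ and, if $i\ge 2$, $n_{i-1}$ is increased by $p_i$. The process stops as soon as $n_r=0$. *)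

theory Defs
  imports "HOL-Probability.Probability"
begin

text \<open>Types are indexed by \<open>{1..r}\<close>; a state \<open>b\<close> gives the number \<open>b i\<close> of balls of type \<open>i\<close>.
  Values at indices outside \<open>{1..r}\<close> are never inspected.\<close>

text \<open>The balls of type \<open>i\<close> are labelled \<open>(i, k)\<close> with \<open>k < b i\<close>.\<close>

definition urn_draw :: "nat \<Rightarrow> (nat \<Rightarrow> nat) \<Rightarrow> nat pmf" where
  "urn_draw r b = map_pmf fst (pmf_of_set (SIGMA i:{1..r}. {..<b i}))"

definition urn_step :: "(nat \<Rightarrow> nat \<Rightarrow> int) \<Rightarrow> nat \<Rightarrow> (nat \<Rightarrow> nat) \<Rightarrow> (nat \<Rightarrow> nat) pmf" where
  "urn_step M r b = map_pmf (\<lambda>i j. nat (int (b j) + M i j)) (urn_draw r b)"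

text \<open>The law of the state at the first time when no ball of type \<open>r\<close> is left.
  It is a subprobability; mass can only be lost on the event that this never happens.\<close>

partial_function (spmf) urn_stopped ::
  "(nat \<Rightarrow> nat \<Rightarrow> int) \<Rightarrow> nat \<Rightarrow> (nat \<Rightarrow> nat) \<Rightarrow> (nat \<Rightarrow> nat) spmf" where
  "urn_stopped M r b =
     (if b r = 0 then return_spmf b
      else bind_spmf (spmf_of_pmf (urn_step M r b)) (urn_stopped M r))"

definition urn_matrix :: "nat \<Rightarrow> (nat \<Rightarrow> nat) \<Rightarrow> (nat \<Rightarrow> nat) \<Rightarrow> nat \<Rightarrow> nat \<Rightarrow> int" where
  "urn_matrix r \<alpha> p i j =
     (if 1 \<le> i \<and> i \<le> r \<and> j = i then - int (\<alpha> i)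
      else if 2 \<le> i \<and> i \<le> r \<and> j = i - 1 then int (p i * \<alpha> (i - 1))
      else 0)"

text \<open>One unit of type \<open>i\<close> consists of \<open>\<alpha> i\<close> balls. From a start with \<open>\<alpha> i * n i\<close> balls of each
  type \<open>i\<close>, all ball counts remain multiples of the respective \<open>\<alpha> i\<close>, so the division is exact.\<close>

definition urn_final_units ::
  "nat \<Rightarrow> (nat \<Rightarrow> nat) \<Rightarrow> (nat \<Rightarrow> nat) \<Rightarrow> (nat \<Rightarrow> nat) \<Rightarrow> (nat \<Rightarrow> nat) spmf" where
  "urn_final_units r \<alpha> p n =
     map_spmf (\<lambda>b l. b l div \<alpha> l) (urn_stopped (urn_matrix r \<alpha> p) r (\<lambda>i. \<alpha> i * n i))"

definition urn_pgf ::
  "nat \<Rightarrow> (nat \<Rightarrow> nat) \<Rightarrow> (nat \<Rightarrow> nat) \<Rightarrow> (nat \<Rightarrow> nat) \<Rightarrow> (nat \<Rightarrow> complex) \<Rightarrow> complex" where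
  "urn_pgf r \<alpha> p n v =
     (LINT X|measure_spmf (urn_final_units r \<alpha> p n). (\<Prod>l = 1..r - 1. v l ^ X l))"

primrec urn_f ::
  "(nat \<Rightarrow> nat) \<Rightarrow> (nat \<Rightarrow> nat) \<Rightarrow> (nat \<Rightarrow> complex) \<Rightarrow> nat \<Rightarrow> real \<Rightarrow> complex" where
  "urn_f \<alpha> p v 0 = (\<lambda>t. 1)"
| "urn_f \<alpha> p v (Suc j) = (\<lambda>t.
     v (Suc j) * complex_of_real (exp (- real (\<alpha> (Suc j)) * t)) +
     (LINT u:{0..t}|lborel.
        complex_of_real (real (\<alpha> (Suc j)) * exp (- real (\<alpha> (Suc j)) * u)) *
        urn_f \<alpha> p v j (t - u) ^ p (Suc j)))"

definition urn_g ::
  "(nat \<Rightarrow> nat) \<Rightarrow> (nat \<Rightarrow> nat) \<Rightarrow> (nat \<Rightarrow> complex) \<Rightarrow> nat \<Rightarrow> real \<Rightarrow> complex" where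
  "urn_g \<alpha> p v j t = urn_f \<alpha> p v j t - v j * complex_of_real (exp (- real (\<alpha> j) * t))"

end

theory Submission imports Defs begin

text \<open>Let every unit of type \<open>l\<close> die independently at rate \<open>\<alpha> l\<close>; the urn is the embedded jump chain
  of this process in continuous time. Then \<open>f\<^sub>l(t)\<close> is the generating function of the progeny of
  one unit after time \<open>t\<close>, whence \<open>f\<^sub>l' = \<alpha>\<^sub>l (f\<^bsub>l-1\<^esub>\<^bsup>p\<^sub>l\<^esup> - f\<^sub>l)\<close>, and \<open>g\<^sub>r\<close> is \<open>f\<^sub>r\<close> with
  \<open>v\<^sub>r = 0\<close>. The integrand is the density \<open>I\<^sub>n(t)\<close> of the time of the last death of type \<open>r\<close>, weighted
  with the generating function of the state left behind, so it satisfies the backward equation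
  \<open>I\<^sub>n' = \<Sum>\<^sub>i \<alpha>\<^sub>i n\<^sub>i (I\<^bsub>n(i)\<^esub> - I\<^sub>n)\<close>, where \<open>n(i)\<close> is the state after a death of type \<open>i\<close>.
  Integrating it over \<open>[0, \<infinity>)\<close> yields the one-step equation of the urn, where the boundary value
  \<open>I\<^sub>n(0)\<close> accounts for the states at which the urn stops. That equation has only one solution,
  because a suitable weighting of the units decreases with every draw.\<close>

section \<open>Replacing a unit by its offspring\<close>

definition replace_unit :: "('a \<Rightarrow> 'a \<Rightarrow> nat) \<Rightarrow> 'a \<Rightarrow> ('a \<Rightarrow> nat) \<Rightarrow> 'a \<Rightarrow> nat" where
  "replace_unit q i n = (\<lambda>j. (n(i := n i - 1)) j + q i j)"

lemma sum_weight_replace_unit: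
  fixes w :: "'a \<Rightarrow> nat"
  assumes "finite A" "i \<in> A" "0 < n i"
  shows "(\<Sum>j\<in>A. w j * replace_unit q i n j) + w i = (\<Sum>j\<in>A. w j * n j) + (\<Sum>j\<in>A. w j * q i j)"
proof -
  have "(\<Sum>j\<in>A. w j * (n(i := n i - 1)) j) + w i = (\<Sum>j\<in>A. w j * n j)"
  proof -
    have "w i * (n i - 1) + w i = w i * n i"
      using assms(3) by (cases "n i") auto
    then show ?thesis
      using assms(1,2) by (simp add: sum.remove)
  qed
  then show ?thesis
    by (simp add: replace_unit_def distrib_left sum.distrib)
qed

lemma replace_unit_induct:
  fixes w :: "'a \<Rightarrow> nat"
  assumes "finite A"
    and decrease: "\<And>i. i \<in> A \<Longrightarrow> (\<Sum>j\<in>A. w j * q i j) < w i"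
    and step: "\<And>n. (\<And>i. i \<in> A \<Longrightarrow> 0 < n i \<Longrightarrow> P (replace_unit q i n)) \<Longrightarrow> P n"
  shows "P n"
proof (induction "\<Sum>j\<in>A. w j * n j" arbitrary: n rule: less_induct)
  case less
  show ?case
  proof (rule step)
    fix i assume "i \<in> A" "0 < n i"
    then show "P (replace_unit q i n)"
      using sum_weight_replace_unit[of A i n w q] decrease[of i] \<open>finite A\<close>
      by (intro less) linarith
  qed
qed

definition multi_power :: "'i set \<Rightarrow> ('i \<Rightarrow> 'a::comm_monoid_mult) \<Rightarrow> ('i \<Rightarrow> nat) \<Rightarrow> 'a" where
  "multi_power A x n = (\<Prod>i\<in>A. x i ^ n i)"

lemma multi_power_remove:
  "finite A \<Longrightarrow> i \<in> A \<Longrightarrow> multi_power A x n = x i ^ n i * multi_power (A - {i}) x n"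
  unfolding multi_power_def by (rule prod.remove)

lemma multi_power_replace_unit:
  assumes "finite A" "i \<in> A"
  shows "multi_power A x (replace_unit q i n) =
    x i ^ (n i - 1) * multi_power (A - {i}) x n * multi_power A x (q i)"
proof -
  have "multi_power A x (replace_unit q i n) =
      multi_power A x (n(i := n i - 1)) * multi_power A x (q i)"
    by (simp add: multi_power_def replace_unit_def power_add prod.distrib)
  also have "multi_power A x (n(i := n i - 1)) =
      x i ^ (n i - 1) * multi_power (A - {i}) x (n(i := n i - 1))"
    using assms by (simp add: multi_power_remove)
  also have "multi_power (A - {i}) x (n(i := n i - 1)) = multi_power (A - {i}) x n"
    by (simp add: multi_power_def)
  finally show ?thesis .
qed

lemma bounded_multi_power_image:
  fixes f :: "'i \<Rightarrow> 'b \<Rightarrow> 'a::real_normed_field"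
  assumes "\<And>i. i \<in> A \<Longrightarrow> bounded (f i ` S)"
  shows "bounded ((\<lambda>s. multi_power A (\<lambda>i. f i s) n) ` S)"
proof -
  have "\<exists>B. \<forall>s\<in>S. norm (f i s) \<le> B" if "i \<in> A" for i
    using assms[OF that] by (auto simp: bounded_iff)
  then obtain B where "\<And>i s. i \<in> A \<Longrightarrow> s \<in> S \<Longrightarrow> norm (f i s) \<le> B i"
    by metis
  then have "norm (multi_power A (\<lambda>i. f i s) n) \<le> (\<Prod>i\<in>A. B i ^ n i)" if "s \<in> S" for s
    unfolding multi_power_def prod_norm[symmetric] norm_power
    using that by (intro prod_mono conjI power_mono zero_le_power) auto
  then show ?thesis
    by (auto simp: bounded_iff)
qed

section \<open>The backward equation of independently reproducing units\<close>

lemma multi_power_has_vector_derivative: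
  fixes \<phi> :: "'i \<Rightarrow> real \<Rightarrow> 'a::real_normed_field"
  assumes "finite A"
    and \<phi>_deriv: "\<And>i. i \<in> A \<Longrightarrow>
      (\<phi> i has_vector_derivative a i *\<^sub>R (multi_power A (\<lambda>j. \<phi> j t) (q i) - \<phi> i t)) (at t within S)"
  shows "((\<lambda>s. multi_power A (\<lambda>j. \<phi> j s) n) has_vector_derivative
    (\<Sum>i\<in>A. (a i * real (n i)) *\<^sub>R (multi_power A (\<lambda>j. \<phi> j t) (replace_unit q i n) -
      multi_power A (\<lambda>j. \<phi> j t) n))) (at t within S)"
proof -
  let ?x = "\<lambda>j. \<phi> j t"
  let ?d = "\<lambda>i. a i *\<^sub>R (multi_power A ?x (q i) - ?x i)"
  have "((\<lambda>s. multi_power A (\<lambda>j. \<phi> j s) n) has_derivative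
      (\<lambda>y. \<Sum>i\<in>A. (of_nat (n i) * (y *\<^sub>R ?d i) * ?x i ^ (n i - 1)) * (\<Prod>j\<in>A - {i}. ?x j ^ n j)))
      (at t within S)"
    unfolding multi_power_def[of A _ n] using \<phi>_deriv
    by (intro has_derivative_prod has_derivative_power) (simp add: has_vector_derivative_def)
  moreover have "(of_nat (n i) * (y *\<^sub>R ?d i) * ?x i ^ (n i - 1)) * (\<Prod>j\<in>A - {i}. ?x j ^ n j) =
      y *\<^sub>R ((a i * real (n i)) *\<^sub>R (multi_power A ?x (replace_unit q i n) - multi_power A ?x n))"
    if "i \<in> A" for i y
    unfolding multi_power_replace_unit[OF \<open>finite A\<close> that]
      multi_power_remove[OF \<open>finite A\<close> that, of _ n]
    by (cases "n i") (simp_all add: multi_power_def scaleR_conv_of_real algebra_simps)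
  ultimately show ?thesis
    by (simp add: has_vector_derivative_def scaleR_sum_right)
qed

text \<open>The derivative of \<open>multi_power A x n\<close> when \<open>x k\<close> moves in direction \<open>e\<close>; truncation in
  \<open>n k - 1\<close> is harmless because of the factor \<open>n k\<close>.\<close>

definition multi_power_variation ::
  "'i set \<Rightarrow> 'i \<Rightarrow> 'a::comm_semiring_1 \<Rightarrow> ('i \<Rightarrow> 'a) \<Rightarrow> ('i \<Rightarrow> nat) \<Rightarrow> 'a" where
  "multi_power_variation A k e x n = of_nat (n k) * e * multi_power A x (n(k := n k - 1))"

lemma multi_power_variation_replace_unit:
  assumes "q i k = 0"
  shows "multi_power_variation A k e x (replace_unit q i n) =
    of_nat ((n(i := n i - 1)) k) * e * multi_power A x (replace_unit q i (n(k := n k - 1)))"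
proof -
  have "(replace_unit q i n)(k := replace_unit q i n k - 1) = replace_unit q i (n(k := n k - 1))"
    and "replace_unit q i n k = (n(i := n i - 1)) k"
    using assms by (auto simp: replace_unit_def fun_eq_iff)
  then show ?thesis
    by (simp add: multi_power_variation_def)
qed

lemma sum_multi_power_variation_replace_unit:
  fixes x :: "'i \<Rightarrow> 'a::real_normed_field" and n :: "'i \<Rightarrow> nat"
  assumes "finite A" "k \<in> A" and no_offspring: "\<And>i. i \<in> A \<Longrightarrow> q i k = 0"
  defines "m \<equiv> n(k := n k - 1)"
  shows "(\<Sum>i\<in>A. (a i * real (n i)) *\<^sub>R
      (multi_power_variation A k e x (replace_unit q i n) - multi_power_variation A k e x n)) =
    of_nat (n k) * e *
      (\<Sum>i\<in>A. (a i * real (m i)) *\<^sub>R (multi_power A x (replace_unit q i m) - multi_power A x m)) -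
    a k *\<^sub>R multi_power_variation A k e x n"
proof -
  define F where "F = multi_power A x"
  define V where "V = multi_power_variation A k e x"
  have V_n: "V n = of_nat (n k) * e * F m"
    by (simp add: V_def F_def m_def multi_power_variation_def)
  have V_replace:
    "V (replace_unit q i n) = of_nat ((n(i := n i - 1)) k) * e * F (replace_unit q i m)"
    if "i \<in> A" for i
    unfolding V_def F_def m_def using no_offspring[OF that]
    by (rule multi_power_variation_replace_unit)
  have off_k: "(a i * real (n i)) *\<^sub>R (V (replace_unit q i n) - V n) =
      of_nat (n k) * e * ((a i * real (m i)) *\<^sub>R (F (replace_unit q i m) - F m))"
    if "i \<in> A - {k}" for i
    using that by (auto simp: V_n V_replace m_def right_diff_distrib)
  have at_k: "(a k * real (n k)) *\<^sub>R (V (replace_unit q k n) - V n) =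
      of_nat (n k) * e * ((a k * real (m k)) *\<^sub>R (F (replace_unit q k m) - F m)) - a k *\<^sub>R V n"
    using \<open>k \<in> A\<close>
    by (cases "n k") (simp_all add: V_n V_replace m_def scaleR_conv_of_real algebra_simps)
  show ?thesis
    unfolding F_def[symmetric] V_def[symmetric] using \<open>finite A\<close> \<open>k \<in> A\<close> at_k
    by (simp add: sum.remove[of A k] sum_distrib_left distrib_left off_k)
qed

text \<open>Since no unit has offspring of type \<open>k\<close>, a variation of \<open>\<phi> k\<close> alone obeys the linear equation
  \<open>e' = - a k e\<close>; differentiating the backward equation of \<open>multi_power A \<phi> n\<close> along it yields
  the same equation for the variation.\<close>

lemma multi_power_variation_has_vector_derivative:
  fixes \<phi> :: "'i \<Rightarrow> real \<Rightarrow> 'a::real_normed_field"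
  assumes "finite A" "k \<in> A"
    and no_offspring: "\<And>i. i \<in> A \<Longrightarrow> q i k = 0"
    and \<phi>_deriv: "\<And>i. i \<in> A \<Longrightarrow>
      (\<phi> i has_vector_derivative a i *\<^sub>R (multi_power A (\<lambda>j. \<phi> j t) (q i) - \<phi> i t)) (at t within S)"
    and e_deriv: "(e has_vector_derivative - a k *\<^sub>R e t) (at t within S)"
  shows "((\<lambda>s. multi_power_variation A k (e s) (\<lambda>j. \<phi> j s) n) has_vector_derivative
    (\<Sum>i\<in>A. (a i * real (n i)) *\<^sub>R
      (multi_power_variation A k (e t) (\<lambda>j. \<phi> j t) (replace_unit q i n) -
       multi_power_variation A k (e t) (\<lambda>j. \<phi> j t) n))) (at t within S)"
proof -
  let ?m = "n(k := n k - 1)" and ?F = "multi_power A (\<lambda>j. \<phi> j t)"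
  let ?V = "multi_power_variation A k (e t) (\<lambda>j. \<phi> j t)"
  have "((\<lambda>s. multi_power_variation A k (e s) (\<lambda>j. \<phi> j s) n) has_vector_derivative
      of_nat (n k) * e t * (\<Sum>i\<in>A. (a i * real (?m i)) *\<^sub>R (?F (replace_unit q i ?m) - ?F ?m)) +
      of_nat (n k) * (- a k *\<^sub>R e t) * ?F ?m) (at t within S)"
    unfolding multi_power_variation_def
    by (intro has_vector_derivative_mult has_vector_derivative_mult_right e_deriv
        multi_power_has_vector_derivative \<open>finite A\<close> \<phi>_deriv)
  then show ?thesis
  proof (rule has_vector_derivative_eq_rhs)
    show "of_nat (n k) * e t * (\<Sum>i\<in>A. (a i * real (?m i)) *\<^sub>R (?F (replace_unit q i ?m) - ?F ?m)) +
        of_nat (n k) * (- a k *\<^sub>R e t) * ?F ?m =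
        (\<Sum>i\<in>A. (a i * real (n i)) *\<^sub>R (?V (replace_unit q i n) - ?V n))"
      using no_offspring by (subst sum_multi_power_variation_replace_unit[OF assms(1,2)])
        (auto simp: multi_power_variation_def)
  qed
qed

section \<open>Exponential smoothing\<close>

definition exp_smoothing :: "real \<Rightarrow> 'a::euclidean_space \<Rightarrow> (real \<Rightarrow> 'a) \<Rightarrow> real \<Rightarrow> 'a" where
  "exp_smoothing a c \<phi> t =
     exp (- a * t) *\<^sub>R c + (LINT u:{0..t}|lborel. (a * exp (- a * u)) *\<^sub>R \<phi> (t - u))"

lemma exp_smoothing_eq_integral:
  assumes "continuous_on {0..t} \<phi>"
  shows "exp_smoothing a c \<phi> t =
    exp (- a * t) *\<^sub>R (c + integral {0..t} (\<lambda>w. (a * exp (a * w)) *\<^sub>R \<phi> w))"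
proof -
  let ?\<psi> = "\<lambda>w. (a * exp (a * w)) *\<^sub>R \<phi> w"
  have "(LINT u:{0..t}|lborel. (a * exp (- a * u)) *\<^sub>R \<phi> (t - u)) =
      (LINT w:{0..t}|lborel. exp (- a * t) *\<^sub>R ?\<psi> w)"
    unfolding set_lebesgue_integral_def
    by (subst lborel_integral_real_affine[where c = "-1" and t = t])
       (auto intro!: Bochner_Integration.integral_cong
          simp: indicator_def algebra_simps simp flip: exp_add)
  also have "\<dots> = exp (- a * t) *\<^sub>R (LINT w:{0..t}|lborel. ?\<psi> w)"
    by (rule set_integral_scaleR_right)
  also have "(LINT w:{0..t}|lborel. ?\<psi> w) = integral {0..t} ?\<psi>"
    by (intro set_borel_integral_eq_integral(2) borel_integrable_atLeastAtMost'
        continuous_intros assms)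
  finally show ?thesis
    by (simp add: exp_smoothing_def scaleR_add_right)
qed

lemma exp_smoothing_has_vector_derivative:
  assumes \<phi>_cont: "continuous_on {0..} \<phi>" and "0 \<le> t"
  shows "(exp_smoothing a c \<phi> has_vector_derivative
    a *\<^sub>R (\<phi> t - exp_smoothing a c \<phi> t)) (at t within {0..})"
proof -
  let ?\<psi> = "\<lambda>w. (a * exp (a * w)) *\<^sub>R \<phi> w"
  have smoothing_eq: "exp_smoothing a c \<phi> s = exp (- a * s) *\<^sub>R (c + integral {0..s} ?\<psi>)" for s
    using continuous_on_subset[OF \<phi>_cont] by (intro exp_smoothing_eq_integral) auto
  have "at t within {0..t + 1} = at t within {0..}"
    by (rule at_within_nhd[of _ "{..<t + 1}"]) auto
  moreover have "continuous_on {0..t + 1} ?\<psi>"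
    by (intro continuous_intros continuous_on_subset[OF \<phi>_cont]) auto
  ultimately have "((\<lambda>s. integral {0..s} ?\<psi>) has_vector_derivative ?\<psi> t) (at t within {0..})"
    using integral_has_vector_derivative[of 0 "t + 1" ?\<psi> t] \<open>0 \<le> t\<close> by simp
  moreover have "((\<lambda>s. exp (- a * s)) has_real_derivative - a * exp (- a * t)) (at t within {0..})"
    by (auto intro!: derivative_eq_intros)
  ultimately have "((\<lambda>s. exp (- a * s) *\<^sub>R (c + integral {0..s} ?\<psi>)) has_vector_derivative
      exp (- a * t) *\<^sub>R (0 + ?\<psi> t) + (- a * exp (- a * t)) *\<^sub>R (c + integral {0..t} ?\<psi>))
      (at t within {0..})"
    by (intro has_vector_derivative_scaleR has_vector_derivative_add has_vector_derivative_const)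
  also have "exp (- a * t) *\<^sub>R (0 + ?\<psi> t) + (- a * exp (- a * t)) *\<^sub>R (c + integral {0..t} ?\<psi>) =
      a *\<^sub>R (\<phi> t - exp_smoothing a c \<phi> t)"
    unfolding smoothing_eq by (simp add: exp_minus algebra_simps)
  finally show ?thesis
    by (simp add: smoothing_eq[abs_def])
qed

lemma continuous_on_exp_smoothing:
  assumes "continuous_on {0..} \<phi>"
  shows "continuous_on {0..} (exp_smoothing a c \<phi>)"
  by (rule continuous_on_vector_derivative) (auto intro: exp_smoothing_has_vector_derivative assms)

lemma norm_exp_smoothing_le:
  assumes \<phi>_cont: "continuous_on {0..t} \<phi>" and \<phi>_le: "\<And>s. s \<in> {0..t} \<Longrightarrow> norm (\<phi> s) \<le> B"
    and "0 \<le> a" "0 \<le> t"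
  shows "norm (exp_smoothing a c \<phi> t) \<le> norm c + B"
proof -
  let ?\<psi> = "\<lambda>u. (a * exp (- a * u)) *\<^sub>R \<phi> (t - u)"
  let ?b = "\<lambda>u. B * (a * exp (- a * u))"
  have "continuous_on {0..t} ?\<psi>"
    by (intro continuous_intros continuous_on_compose2[OF \<phi>_cont]) auto
  then have \<psi>_integrable: "set_integrable lborel {0..t} ?\<psi>"
    by (rule borel_integrable_atLeastAtMost')
  have "norm (LINT u:{0..t}|lborel. ?\<psi> u) \<le> (LINT u:{0..t}|lborel. norm (?\<psi> u))"
    by (rule set_integral_norm_bound[OF \<psi>_integrable])
  also have "\<dots> \<le> (LINT u:{0..t}|lborel. ?b u)"
  proof (rule set_integral_mono)
    show "set_integrable lborel {0..t} (\<lambda>u. norm (?\<psi> u))"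
      using \<psi>_integrable by (rule set_integrable_norm)
    show "set_integrable lborel {0..t} ?b"
      by (intro borel_integrable_atLeastAtMost' continuous_intros)
    show "norm (?\<psi> u) \<le> ?b u" if "u \<in> {0..t}" for u
      using mult_right_mono[OF \<phi>_le[of "t - u"], of "a * exp (- a * u)"] that \<open>0 \<le> a\<close>
      by (simp add: mult_ac)
  qed
  also have "\<dots> = - B * exp (- a * t) - - B * exp (- a * 0)"
    unfolding set_lebesgue_integral_def using \<open>0 \<le> t\<close>
    by (intro integral_FTC_atLeastAtMost continuous_intros)
       (auto intro!: derivative_eq_intros simp flip: has_real_derivative_iff_has_vector_derivative)
  also have "\<dots> \<le> B"
    using order_trans[OF norm_ge_zero \<phi>_le[of 0]] \<open>0 \<le> t\<close> by simp
  finally have "norm (LINT u:{0..t}|lborel. ?\<psi> u) \<le> B" .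
  moreover have "norm (exp (- a * t) *\<^sub>R c) \<le> norm c"
    using \<open>0 \<le> a\<close> \<open>0 \<le> t\<close> by (simp add: mult_left_le_one_le)
  ultimately show ?thesis
    unfolding exp_smoothing_def by (intro norm_triangle_le add_mono)
qed

section \<open>Integrals over a half-line\<close>

lemma set_integrable_exp_bounded:
  fixes f :: "real \<Rightarrow> 'a::euclidean_space"
  assumes f_cont: "continuous_on {0..} f"
    and bound: "\<And>t. 0 \<le> t \<Longrightarrow> norm (f t) \<le> B * exp (- (a * t))"
    and "0 < a"
  shows "set_integrable lborel {0..} f"
proof (rule set_integrable_bound)
  have "set_integrable lborel {0<..} (\<lambda>t. exp (- (t * a)))"
    using \<open>0 < a\<close> by (rule integrable_I0i_exp_mscale)
  then have "set_integrable lborel {0..} (\<lambda>t. exp (- (t * a)))"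
    by (subst set_integrable_discrete_difference[where X = "{0}" and B = "{0<..}"]) auto
  then show "set_integrable lborel {0..} (\<lambda>t. B * exp (- (t * a)))"
    by (rule set_integrable_mult_right)
  show "set_borel_measurable lborel {0..} f"
    unfolding set_borel_measurable_def
    using borel_measurable_continuous_on_indicator[OF _ f_cont] by simp
  show "AE t in lborel. t \<in> {0..} \<longrightarrow> norm (f t) \<le> norm (B * exp (- (t * a)))"
    using bound by (intro AE_I2) (force intro: order_trans[OF _ abs_ge_self] simp: mult.commute)
qed

lemma integral_FTC_atLeast_tendsto:
  fixes F :: "real \<Rightarrow> 'a::euclidean_space"
  assumes F_deriv: "\<And>t. a \<le> t \<Longrightarrow> (F has_vector_derivative f t) (at t within {a..})"
    and f_cont: "continuous_on {a..} f" and f_integrable: "set_integrable lborel {a..} f"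
    and F_tendsto: "(F \<longlongrightarrow> L) at_top"
  shows "(LINT t:{a..}|lborel. f t) = L - F a"
proof (rule tendsto_unique[OF trivial_limit_at_top_linorder])
  show "((\<lambda>b. LINT t:{a..b}|lborel. f t) \<longlongrightarrow> (LINT t:{a..}|lborel. f t)) at_top"
    by (rule tendsto_set_lebesgue_integral_at_top) (use f_integrable in auto)
  have "(LINT t:{a..b}|lborel. f t) = F b - F a" if "a \<le> b" for b
    unfolding set_lebesgue_integral_def using that
    by (intro integral_FTC_atLeastAtMost continuous_on_subset[OF f_cont]
        has_vector_derivative_within_subset[OF F_deriv])
       auto
  then have "eventually (\<lambda>b. F b - F a = (LINT t:{a..b}|lborel. f t)) at_top"
    by (intro eventually_mono[OF eventually_ge_at_top[of a]]) simp
  moreover have "((\<lambda>b. F b - F a) \<longlongrightarrow> L - F a) at_top"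
    by (intro tendsto_intros F_tendsto)
  ultimately show "((\<lambda>b. LINT t:{a..b}|lborel. f t) \<longlongrightarrow> L - F a) at_top"
    by (rule Lim_transform_eventually[rotated])
qed

lemma
  fixes f :: "'i \<Rightarrow> 'a \<Rightarrow> 'b::{banach, second_countable_topology}"
  assumes "\<And>i. i \<in> I \<Longrightarrow> set_integrable M A (f i)"
  shows set_integrable_sum: "set_integrable M A (\<lambda>x. \<Sum>i\<in>I. f i x)"
    and set_integral_sum: "(LINT x:A|M. (\<Sum>i\<in>I. f i x)) = (\<Sum>i\<in>I. LINT x:A|M. f i x)"
  using assms unfolding set_integrable_def set_lebesgue_integral_def scaleR_sum_right
  by (auto intro: Bochner_Integration.integrable_sum Bochner_Integration.integral_sum)

section \<open>Urns whose balls come in units\<close>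

lemma
  assumes balls_pos: "0 < (\<Sum>i=1..r. b i)"
  shows set_pmf_urn_draw: "set_pmf (urn_draw r b) = {i\<in>{1..r}. 0 < b i}"
    and pmf_urn_draw: "i \<in> {1..r} \<Longrightarrow> pmf (urn_draw r b) i = real (b i) / real (\<Sum>i=1..r. b i)"
proof -
  let ?balls = "SIGMA i:{1..r}. {..<b i}"
  have card_balls: "card ?balls = (\<Sum>i=1..r. b i)" by simp
  have finite_balls: "finite ?balls" by auto
  have balls_nonempty: "?balls \<noteq> {}" using balls_pos card_balls by (metis card.empty less_irrefl)
  show "set_pmf (urn_draw r b) = {i\<in>{1..r}. 0 < b i}"
    using finite_balls balls_nonempty by (auto simp: urn_draw_def image_iff)
  assume "i \<in> {1..r}"
  then have "?balls \<inter> fst -` {i} = {i} \<times> {..<b i}" by auto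
  then show "pmf (urn_draw r b) i = real (b i) / real (\<Sum>i=1..r. b i)"
    unfolding urn_draw_def pmf_map measure_pmf_of_set[OF balls_nonempty finite_balls] card_balls
    by simp
qed

lemma integral_measure_spmf_eq_expectation:
  fixes h :: "'a \<Rightarrow> 'b::{banach, second_countable_topology}"
  shows "(LINT x|measure_spmf p. h x) = measure_pmf.expectation p (case_option 0 h)"
  by (auto simp: measure_spmf_def integral_distr integral_restrict_space indicator_def
      split: option.split intro!: Bochner_Integration.integral_cong)

locale unit_urn =
  fixes r :: nat and \<alpha> :: "nat \<Rightarrow> nat" and q :: "nat \<Rightarrow> nat \<Rightarrow> nat"
    and M :: "nat \<Rightarrow> nat \<Rightarrow> int" and w :: "nat \<Rightarrow> nat"
  assumes r_pos: "1 \<le> r" and \<alpha>_r_pos: "1 \<le> \<alpha> r"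
    and matrix_eq: "\<And>i j. i \<in> {1..r} \<Longrightarrow> M i j = int (\<alpha> j) * (int (q i j) - (if j = i then 1 else 0))"
    and weight_offspring_less: "\<And>i. i \<in> {1..r} \<Longrightarrow> (\<Sum>j=1..r. w j * q i j) < w i"
begin

lemma unit_induct [case_names step]:
  assumes "\<And>n. (\<And>i. i \<in> {1..r} \<Longrightarrow> 0 < n i \<Longrightarrow> P (replace_unit q i n)) \<Longrightarrow> P n"
  shows "P n"
  using finite_atLeastAtMost weight_offspring_less assms by (rule replace_unit_induct)

definition balls :: "(nat \<Rightarrow> nat) \<Rightarrow> nat \<Rightarrow> nat" where
  "balls n i = \<alpha> i * n i"

lemma balls_r_eq_0_iff: "balls n r = 0 \<longleftrightarrow> n r = 0"
  using \<alpha>_r_pos by (auto simp: balls_def)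

lemma sum_balls_pos:
  assumes "n r \<noteq> 0"
  shows "0 < (\<Sum>i=1..r. balls n i)"
  using assms r_pos balls_r_eq_0_iff[of n] by (intro sum_pos2[of _ r]) auto

lemma set_pmf_urn_draw_balls_subset:
  assumes "n r \<noteq> 0"
  shows "set_pmf (urn_draw r (balls n)) \<subseteq> {i\<in>{1..r}. 0 < n i}"
  using sum_balls_pos[of n] assms by (auto simp: set_pmf_urn_draw balls_def)

lemma balls_add_matrix:
  assumes "i \<in> {1..r}" "0 < n i"
  shows "(\<lambda>j. nat (int (balls n j) + M i j)) = balls (replace_unit q i n)"
proof
  fix j
  have "int (balls n j) + M i j = int (balls (replace_unit q i n) j)"
    using assms by (auto simp: matrix_eq balls_def replace_unit_def of_nat_diff algebra_simps)
  then show "nat (int (balls n j) + M i j) = balls (replace_unit q i n) j"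
    by simp
qed

lemma urn_stopped_balls_step:
  assumes "n r \<noteq> 0"
  shows "urn_stopped M r (balls n) =
    bind_pmf (urn_draw r (balls n)) (\<lambda>i. urn_stopped M r (balls (replace_unit q i n)))"
proof -
  have "urn_stopped M r (balls n) =
      bind_pmf (urn_draw r (balls n)) (\<lambda>i. urn_stopped M r (\<lambda>j. nat (int (balls n j) + M i j)))"
    using assms by (subst urn_stopped.simps) (simp add: balls_r_eq_0_iff urn_step_def bind_map_pmf)
  also have "\<dots> = bind_pmf (urn_draw r (balls n)) (\<lambda>i. urn_stopped M r (balls (replace_unit q i n)))"
  proof (rule bind_pmf_cong[OF refl])
    fix i assume "i \<in> set_pmf (urn_draw r (balls n))"
    then have "i \<in> {1..r}" "0 < n i"
      using set_pmf_urn_draw_balls_subset[of n] assms by auto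
    then show "urn_stopped M r (\<lambda>j. nat (int (balls n j) + M i j)) =
        urn_stopped M r (balls (replace_unit q i n))"
      by (simp add: balls_add_matrix)
  qed
  finally show ?thesis .
qed

lemma finite_set_pmf_urn_stopped: "finite (set_pmf (urn_stopped M r (balls n)))"
proof (induction n rule: unit_induct)
  case (step n)
  show ?case
  proof (cases "n r = 0")
    case True
    then show ?thesis
      by (simp add: urn_stopped.simps balls_r_eq_0_iff)
  next
    case False
    note draw_subset = set_pmf_urn_draw_balls_subset[of n, OF False]
    have "finite (set_pmf (urn_draw r (balls n)))"
      using draw_subset by (rule finite_subset) simp
    then show ?thesis
      using False draw_subset step.IH by (auto simp: urn_stopped_balls_step)
  qed
qed

lemma expectation_urn_stopped_step:
  fixes h :: "(nat \<Rightarrow> nat) \<Rightarrow> 'a::{banach, second_countable_topology}"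
  assumes "n r \<noteq> 0"
  shows "real (\<Sum>i=1..r. balls n i) *\<^sub>R (LINT b|measure_spmf (urn_stopped M r (balls n)). h b) =
    (\<Sum>i=1..r. real (balls n i) *\<^sub>R
      (LINT b|measure_spmf (urn_stopped M r (balls (replace_unit q i n))). h b))"
proof -
  define N where "N = (\<Sum>i=1..r. balls n i)"
  note N_pos = sum_balls_pos[of n, OF assms, folded N_def]
  let ?E = "\<lambda>n. LINT b|measure_spmf (urn_stopped M r (balls n)). h b"
  have "?E n = (\<Sum>i=1..r. pmf (urn_draw r (balls n)) i *\<^sub>R ?E (replace_unit q i n))"
    unfolding integral_measure_spmf_eq_expectation urn_stopped_balls_step[of n, OF assms]
    by (rule pmf_expectation_bind)
       (use set_pmf_urn_draw_balls_subset[of n, OF assms] in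
         \<open>auto simp: finite_set_pmf_urn_stopped\<close>)
  also have "\<dots> = (\<Sum>i=1..r. (real (balls n i) / real N) *\<^sub>R ?E (replace_unit q i n))"
    using N_pos unfolding N_def by (intro sum.cong refl) (simp only: pmf_urn_draw)
  finally show ?thesis
    unfolding N_def[symmetric] using N_pos by (simp add: scaleR_sum_right)
qed

theorem expectation_urn_stopped_eqI:
  fixes h J :: "(nat \<Rightarrow> nat) \<Rightarrow> 'a::{banach, second_countable_topology}"
  assumes stop: "\<And>n. n r = 0 \<Longrightarrow> h (balls n) = J n"
    and rec: "\<And>n. n r \<noteq> 0 \<Longrightarrow> real (\<Sum>i=1..r. balls n i) *\<^sub>R J n =
      (\<Sum>i=1..r. real (balls n i) *\<^sub>R J (replace_unit q i n))"
  shows "(LINT b|measure_spmf (urn_stopped M r (balls n)). h b) = J n"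
proof (induction n rule: unit_induct)
  case (step n)
  let ?E = "\<lambda>n. LINT b|measure_spmf (urn_stopped M r (balls n)). h b"
  show "?E n = J n"
  proof (cases "n r = 0")
    case True
    then show ?thesis
      by (simp add: urn_stopped.simps balls_r_eq_0_iff integral_measure_spmf_eq_expectation stop)
  next
    case False
    have "real (balls n i) *\<^sub>R ?E (replace_unit q i n) =
        real (balls n i) *\<^sub>R J (replace_unit q i n)"
      if "i \<in> {1..r}" for i
      using that by (cases "n i = 0") (simp_all add: step.IH balls_def[of n])
    then have "real (\<Sum>i=1..r. balls n i) *\<^sub>R ?E n =
        (\<Sum>i=1..r. real (balls n i) *\<^sub>R J (replace_unit q i n))"
      unfolding expectation_urn_stopped_step[of n, OF False] by (rule sum.cong[OF refl])
    also have "\<dots> = real (\<Sum>i=1..r. balls n i) *\<^sub>R J n"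
      using False by (rule rec[symmetric])
    finally have "real (\<Sum>i=1..r. balls n i) *\<^sub>R ?E n = real (\<Sum>i=1..r. balls n i) *\<^sub>R J n" .
    then show ?thesis
      using sum_balls_pos[of n, OF False]
      by (metis of_nat_0_less_iff less_irrefl scaleR_left_imp_eq)
  qed
qed

end

section \<open>The chain of types\<close>

definition chain_offspring :: "(nat \<Rightarrow> nat) \<Rightarrow> nat \<Rightarrow> nat \<Rightarrow> nat" where
  "chain_offspring p i j = (if 2 \<le> i \<and> j = i - 1 then p i else 0)"

lemma multi_power_chain_offspring:
  assumes "finite A"
  shows "multi_power A x (chain_offspring p i) = (if 2 \<le> i \<and> i - 1 \<in> A then x (i - 1) ^ p i else 1)"
proof -
  have "multi_power A x (chain_offspring p i) =
      (\<Prod>j\<in>A. if j = i - 1 then if 2 \<le> i then x (i - 1) ^ p i else 1 else 1)"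
    unfolding multi_power_def chain_offspring_def by (intro prod.cong) auto
  then show ?thesis
    using assms by simp
qed

primrec chain_weight :: "(nat \<Rightarrow> nat) \<Rightarrow> nat \<Rightarrow> nat" where
  "chain_weight p 0 = 0"
| "chain_weight p (Suc i) = 1 + p (Suc i) * chain_weight p i"

lemma sum_chain_weight_offspring:
  assumes "i \<in> {1..r}"
  shows "(\<Sum>j=1..r. chain_weight p j * chain_offspring p i j) + 1 = chain_weight p i"
proof -
  have "(\<Sum>j=1..r. chain_weight p j * chain_offspring p i j) =
      (\<Sum>j=1..r. if j = i - 1 then if 2 \<le> i then chain_weight p j * p i else 0 else 0)"
    unfolding chain_offspring_def by (intro sum.cong) auto
  also have "\<dots> = chain_weight p (i - 1) * p i"
    using assms by (cases "i = 1") (auto simp: numeral_2_eq_2 Suc_le_eq)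
  finally show ?thesis
    using assms by (cases i) auto
qed

lemma unit_urn_chain:
  assumes "1 \<le> r" "1 \<le> \<alpha> r"
  shows "unit_urn r \<alpha> (chain_offspring p) (urn_matrix r \<alpha> p) (chain_weight p)"
proof
  show "urn_matrix r \<alpha> p i j = int (\<alpha> j) * (int (chain_offspring p i j) - (if j = i then 1 else 0))"
    if "i \<in> {1..r}" for i j
    using that by (auto simp: urn_matrix_def chain_offspring_def)
  show "(\<Sum>j=1..r. chain_weight p j * chain_offspring p i j) < chain_weight p i"
    if "i \<in> {1..r}" for i
    using sum_chain_weight_offspring[OF that, of p] by linarith
qed (use assms in auto)

lemma urn_f_Suc_eq_exp_smoothing:
  "urn_f \<alpha> p v (Suc j) =
    exp_smoothing (real (\<alpha> (Suc j))) (v (Suc j)) (\<lambda>s. urn_f \<alpha> p v j s ^ p (Suc j))"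
  by (simp add: exp_smoothing_def scaleR_conv_of_real fun_eq_iff mult.commute)

lemma continuous_on_urn_f: "continuous_on {0..} (urn_f \<alpha> p v j)"
proof (induction j)
  case (Suc j)
  then have "continuous_on {0..} (\<lambda>s. urn_f \<alpha> p v j s ^ p (Suc j))"
    by (intro continuous_intros)
  then show ?case
    unfolding urn_f_Suc_eq_exp_smoothing by (rule continuous_on_exp_smoothing)
qed simp

lemma urn_f_has_vector_derivative:
  assumes "i \<in> {1..r}" "0 \<le> t"
  shows "(urn_f \<alpha> p v i has_vector_derivative real (\<alpha> i) *\<^sub>R
    (multi_power {1..r} (\<lambda>j. urn_f \<alpha> p v j t) (chain_offspring p i) - urn_f \<alpha> p v i t))
    (at t within {0..})"
proof -
  obtain j where i: "i = Suc j"
    using assms(1) by (cases i) auto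
  have "multi_power {1..r} (\<lambda>j. urn_f \<alpha> p v j t) (chain_offspring p i) = urn_f \<alpha> p v j t ^ p i"
    using assms(1) by (cases j) (auto simp: i multi_power_chain_offspring)
  moreover have "continuous_on {0..} (\<lambda>s. urn_f \<alpha> p v j s ^ p i)"
    by (intro continuous_intros continuous_on_urn_f)
  ultimately show ?thesis
    using exp_smoothing_has_vector_derivative[OF _ assms(2)]
    by (simp only: i urn_f_Suc_eq_exp_smoothing)
qed

lemma urn_f_0: "1 \<le> j \<Longrightarrow> urn_f \<alpha> p v j 0 = v j"
  by (cases j)
     (auto simp: urn_f_Suc_eq_exp_smoothing exp_smoothing_eq_integral simp del: urn_f.simps)

lemma bounded_urn_f_image: "bounded (urn_f \<alpha> p v j ` {0..})"
proof (induction j)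
  case (Suc j)
  then obtain B where B: "\<And>t. 0 \<le> t \<Longrightarrow> norm (urn_f \<alpha> p v j t) \<le> B"
    by (auto simp: bounded_iff)
  have "norm (urn_f \<alpha> p v (Suc j) t) \<le> norm (v (Suc j)) + B ^ p (Suc j)" if "0 \<le> t" for t
    unfolding urn_f_Suc_eq_exp_smoothing
  proof (rule norm_exp_smoothing_le)
    show "continuous_on {0..t} (\<lambda>s. urn_f \<alpha> p v j s ^ p (Suc j))"
      by (intro continuous_intros continuous_on_subset[OF continuous_on_urn_f]) auto
    show "norm (urn_f \<alpha> p v j s ^ p (Suc j)) \<le> B ^ p (Suc j)" if "s \<in> {0..t}" for s
      using that by (auto simp: norm_power intro!: power_mono B)
  qed (use that in auto)
  then show ?case
    unfolding bounded_iff by (intro exI[of _ "norm (v (Suc j)) + B ^ p (Suc j)"]) auto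
qed (simp add: image_constant_conv)

lemma urn_f_cong: "(\<And>l. 1 \<le> l \<Longrightarrow> l \<le> j \<Longrightarrow> v l = w l) \<Longrightarrow> urn_f \<alpha> p v j = urn_f \<alpha> p w j"
  by (induction j) auto

lemma urn_f_fun_upd_0:
  assumes "1 \<le> j"
  shows "urn_f \<alpha> p (v(j := 0)) j t = urn_g \<alpha> p v j t"
  using assms urn_f_cong[of "j - 1" "v(j := 0)" v \<alpha> p] by (cases j) (auto simp: urn_g_def)

section \<open>The density of the stopping time\<close>

definition urn_density ::
  "nat \<Rightarrow> (nat \<Rightarrow> nat) \<Rightarrow> (nat \<Rightarrow> nat) \<Rightarrow> (nat \<Rightarrow> complex) \<Rightarrow> (nat \<Rightarrow> nat) \<Rightarrow> real \<Rightarrow> complex" where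
  "urn_density r \<alpha> p v n t =
     urn_g \<alpha> p v r t ^ (n r - 1) * v (r - 1) ^ p r *
     complex_of_real (real (\<alpha> r) * real (n r) * exp (- real (\<alpha> r) * t)) *
     (\<Prod>l = 1..r - 1. urn_f \<alpha> p v l t ^ n l)"

text \<open>As \<open>\<partial>f\<^sub>r/\<partial>v\<^sub>r = e\<^bsup>-\<alpha>\<^sub>r t\<^esup>\<close>, the density is \<open>\<alpha>\<^sub>r v\<^bsub>r-1\<^esub>\<^bsup>p\<^sub>r\<^esup>\<close> times the derivative of
  \<open>\<Prod>\<^sub>l f\<^sub>l\<^bsup>n\<^sub>l\<^esup>\<close> with respect to \<open>v\<^sub>r\<close> at \<open>v\<^sub>r = 0\<close>.\<close>

lemma urn_density_eq_variation:
  assumes "1 \<le> r"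
  shows "urn_density r \<alpha> p v n t =
    multi_power_variation {1..r} r
      (of_nat (\<alpha> r) * v (r - 1) ^ p r * complex_of_real (exp (- real (\<alpha> r) * t)))
      (\<lambda>l. urn_f \<alpha> p (v(r := 0)) l t) n"
proof -
  let ?x = "\<lambda>l. urn_f \<alpha> p (v(r := 0)) l t"
  have "multi_power {1..r - 1} ?x (n(r := n r - 1)) = (\<Prod>l = 1..r - 1. urn_f \<alpha> p v l t ^ n l)"
    unfolding multi_power_def
  proof (rule prod.cong[OF refl])
    fix l assume "l \<in> {1..r - 1}"
    then show "?x l ^ (n(r := n r - 1)) l = urn_f \<alpha> p v l t ^ n l"
      using urn_f_cong[of l "v(r := 0)" v \<alpha> p] by auto
  qed
  moreover have "{1..r} - {r} = {1..r - 1}"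
    using assms by auto
  ultimately have "multi_power {1..r} ?x (n(r := n r - 1)) =
      urn_g \<alpha> p v r t ^ (n r - 1) * (\<Prod>l = 1..r - 1. urn_f \<alpha> p v l t ^ n l)"
    using assms by (subst multi_power_remove[of _ r]) (simp_all add: urn_f_fun_upd_0)
  then show ?thesis
    by (simp add: urn_density_def multi_power_variation_def)
qed

lemma urn_density_has_vector_derivative:
  assumes "1 \<le> r" "0 \<le> t"
  shows "(urn_density r \<alpha> p v n has_vector_derivative
    (\<Sum>i=1..r. real (\<alpha> i * n i) *\<^sub>R (urn_density r \<alpha> p v (replace_unit (chain_offspring p) i n) t -
      urn_density r \<alpha> p v n t))) (at t within {0..})"
proof -
  let ?e = "\<lambda>t. of_nat (\<alpha> r) * v (r - 1) ^ p r * complex_of_real (exp (- real (\<alpha> r) * t))"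
  have "((\<lambda>t. exp (- real (\<alpha> r) * t)) has_real_derivative - real (\<alpha> r) * exp (- real (\<alpha> r) * t))
      (at t within {0..})"
    by (auto intro!: derivative_eq_intros)
  then have "(?e has_vector_derivative
      of_nat (\<alpha> r) * v (r - 1) ^ p r * complex_of_real (- real (\<alpha> r) * exp (- real (\<alpha> r) * t)))
      (at t within {0..})"
    by (intro has_vector_derivative_mult_right has_vector_derivative_of_real)
  then have "(?e has_vector_derivative - real (\<alpha> r) *\<^sub>R ?e t) (at t within {0..})"
    by (rule has_vector_derivative_eq_rhs) (simp add: scaleR_conv_of_real)
  moreover have "chain_offspring p i r = 0" if "i \<in> {1..r}" for i
    using that by (auto simp: chain_offspring_def)
  ultimately show ?thesis
    unfolding urn_density_eq_variation[OF \<open>1 \<le> r\<close>, abs_def] of_nat_mult using assms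
    by (intro multi_power_variation_has_vector_derivative urn_f_has_vector_derivative) auto
qed

lemma continuous_on_urn_density:
  assumes "1 \<le> r"
  shows "continuous_on {0..} (urn_density r \<alpha> p v n)"
  by (rule continuous_on_vector_derivative) (auto intro: urn_density_has_vector_derivative assms)

lemma urn_density_exp_bounded:
  assumes "1 \<le> r"
  shows "\<exists>B. \<forall>t\<ge>0. norm (urn_density r \<alpha> p v n t) \<le> B * exp (- (real (\<alpha> r) * t))"
proof -
  let ?F = "\<lambda>t. multi_power {1..r} (\<lambda>l. urn_f \<alpha> p (v(r := 0)) l t) (n(r := n r - 1))"
  let ?c = "real (n r) * (real (\<alpha> r) * norm (v (r - 1)) ^ p r)"
  have "bounded (?F ` {0..})"
    by (intro bounded_multi_power_image bounded_urn_f_image)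
  then obtain B where B: "\<And>t. 0 \<le> t \<Longrightarrow> norm (?F t) \<le> B"
    by (auto simp: bounded_iff)
  have "norm (urn_density r \<alpha> p v n t) \<le> ?c * B * exp (- (real (\<alpha> r) * t))" if "0 \<le> t" for t
  proof -
    have "norm (urn_density r \<alpha> p v n t) = ?c * exp (- (real (\<alpha> r) * t)) * norm (?F t)"
      using assms
      by (simp add: urn_density_eq_variation multi_power_variation_def norm_mult norm_power)
    also have "\<dots> \<le> ?c * exp (- (real (\<alpha> r) * t)) * B"
      using that by (intro mult_left_mono B) auto
    finally show ?thesis
      by (simp add: mult_ac)
  qed
  then show ?thesis by blast
qed

lemma set_integrable_urn_density:
  assumes "1 \<le> r" "1 \<le> \<alpha> r"
  shows "set_integrable lborel {0..} (urn_density r \<alpha> p v n)"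
proof -
  obtain B where "\<And>t. 0 \<le> t \<Longrightarrow> norm (urn_density r \<alpha> p v n t) \<le> B * exp (- (real (\<alpha> r) * t))"
    using urn_density_exp_bounded[OF assms(1)] by metis
  then show ?thesis
    using assms
    by (intro set_integrable_exp_bounded[of _ B "real (\<alpha> r)"] continuous_on_urn_density) auto
qed

lemma urn_density_tendsto_0:
  assumes "1 \<le> r" "1 \<le> \<alpha> r"
  shows "(urn_density r \<alpha> p v n \<longlongrightarrow> 0) at_top"
proof -
  obtain B where "\<And>t. 0 \<le> t \<Longrightarrow> norm (urn_density r \<alpha> p v n t) \<le> B * exp (- (real (\<alpha> r) * t))"
    using urn_density_exp_bounded[OF assms(1)] by metis
  then have "eventually (\<lambda>t. norm (urn_density r \<alpha> p v n t) \<le> B * exp (- (real (\<alpha> r) * t))) at_top"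
    by (intro eventually_mono[OF eventually_ge_at_top[of 0]])
  moreover have "((\<lambda>t. B * exp (- (real (\<alpha> r) * t))) \<longlongrightarrow> 0) at_top"
    using assms(2) by (intro tendsto_mult_right_zero) real_asymp
  ultimately show ?thesis
    by (rule Lim_null_comparison)
qed

lemma sum_integral_urn_density:
  assumes "1 \<le> r" "1 \<le> \<alpha> r"
  shows "(\<Sum>i=1..r. real (\<alpha> i * n i) *\<^sub>R
      ((LINT t:{0..}|lborel. urn_density r \<alpha> p v (replace_unit (chain_offspring p) i n) t) -
       (LINT t:{0..}|lborel. urn_density r \<alpha> p v n t))) = - urn_density r \<alpha> p v n 0"
proof -
  let ?I = "urn_density r \<alpha> p v"
  let ?d = "\<lambda>i t. real (\<alpha> i * n i) *\<^sub>R (?I (replace_unit (chain_offspring p) i n) t - ?I n t)"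
  note I_integrable =
    set_integrable_urn_density[where r = r and \<alpha> = \<alpha> and p = p and v = v, OF assms]
  have d_integrable: "set_integrable lborel {0..} (?d i)" for i
    by (intro set_integrable_scaleR_right set_integral_diff(1) I_integrable)
  have "(\<Sum>i=1..r. real (\<alpha> i * n i) *\<^sub>R
      ((LINT t:{0..}|lborel. ?I (replace_unit (chain_offspring p) i n) t) -
       (LINT t:{0..}|lborel. ?I n t))) =
      (\<Sum>i=1..r. LINT t:{0..}|lborel. ?d i t)"
    by (simp only: set_integral_scaleR_right set_integral_diff(2)[OF I_integrable I_integrable])
  also have "\<dots> = (LINT t:{0..}|lborel. (\<Sum>i=1..r. ?d i t))"
    by (rule set_integral_sum[OF d_integrable, symmetric])
  also have "\<dots> = 0 - ?I n 0"
    using assms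
    by (intro integral_FTC_atLeast_tendsto urn_density_has_vector_derivative urn_density_tendsto_0
        set_integrable_sum d_integrable continuous_intros continuous_on_urn_density) auto
  finally show ?thesis by simp
qed

definition stopped_power :: "nat \<Rightarrow> (nat \<Rightarrow> 'a::comm_semiring_1) \<Rightarrow> (nat \<Rightarrow> nat) \<Rightarrow> 'a" where
  "stopped_power r v n = (if n r = 0 then \<Prod>l = 1..r - 1. v l ^ n l else 0)"

lemma stopped_power_replace_unit_chain_offspring:
  assumes "2 \<le> r" "n r = 1"
  shows "stopped_power r v (replace_unit (chain_offspring p) r n) =
    v (r - 1) ^ p r * (\<Prod>l = 1..r - 1. v l ^ n l)"
proof -
  let ?n = "replace_unit (chain_offspring p) r n"
  have "(\<Prod>l = 1..r - 1. v l ^ ?n l) = (\<Prod>l = 1..r - 1. v l ^ n l * v l ^ chain_offspring p r l)"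
    using assms(1) by (intro prod.cong) (auto simp: replace_unit_def power_add)
  also have "\<dots> = (\<Prod>l = 1..r - 1. v l ^ n l) * multi_power {1..r - 1} v (chain_offspring p r)"
    by (simp add: prod.distrib multi_power_def)
  also have "multi_power {1..r - 1} v (chain_offspring p r) = v (r - 1) ^ p r"
    using assms(1) by (auto simp: multi_power_chain_offspring)
  finally show ?thesis
    using assms by (simp add: stopped_power_def replace_unit_def chain_offspring_def mult.commute)
qed

lemma urn_density_0:
  assumes "2 \<le> r" "n r \<noteq> 0"
  shows "urn_density r \<alpha> p v n 0 =
    (\<Sum>i=1..r. real (\<alpha> i * n i) *\<^sub>R stopped_power r v (replace_unit (chain_offspring p) i n))"
proof -
  let ?s = "\<lambda>i. stopped_power r v (replace_unit (chain_offspring p) i n)"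
  have urn_g_0: "urn_g \<alpha> p v r 0 = 0"
    using assms(1) by (simp add: urn_g_def urn_f_0)
  have "?s i = 0" if "i \<in> {1..r} - {r}" for i
    using that assms(2) by (auto simp: stopped_power_def replace_unit_def)
  then have "(\<Sum>i=1..r. real (\<alpha> i * n i) *\<^sub>R ?s i) = real (\<alpha> r * n r) *\<^sub>R ?s r"
    using assms(1) by (subst sum.remove[of _ r]) auto
  also have "\<dots> = urn_density r \<alpha> p v n 0"
  proof (cases "n r = 1")
    case True
    then show ?thesis
      using assms(1)
      by (simp add: stopped_power_replace_unit_chain_offspring urn_density_def urn_f_0
          scaleR_conv_of_real)
  next
    case False
    then have "?s r = 0" "0 < n r - 1"
      using assms(2) by (auto simp: stopped_power_def replace_unit_def)
    then show ?thesis
      by (simp add: urn_density_def urn_g_0)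
  qed
  finally show ?thesis by simp
qed

definition urn_expectation ::
  "nat \<Rightarrow> (nat \<Rightarrow> nat) \<Rightarrow> (nat \<Rightarrow> nat) \<Rightarrow> (nat \<Rightarrow> complex) \<Rightarrow> (nat \<Rightarrow> nat) \<Rightarrow> complex" where
  "urn_expectation r \<alpha> p v n = stopped_power r v n + (LINT t:{0..}|lborel. urn_density r \<alpha> p v n t)"

lemma urn_expectation_step:
  assumes "2 \<le> r" "1 \<le> \<alpha> r" "n r \<noteq> 0"
  shows "real (\<Sum>i=1..r. \<alpha> i * n i) *\<^sub>R urn_expectation r \<alpha> p v n =
    (\<Sum>i=1..r. real (\<alpha> i * n i) *\<^sub>R urn_expectation r \<alpha> p v (replace_unit (chain_offspring p) i n))"
proof -
  let ?n = "\<lambda>i. replace_unit (chain_offspring p) i n"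
  let ?L = "\<lambda>n. LINT t:{0..}|lborel. urn_density r \<alpha> p v n t"
  have "(\<Sum>i=1..r. real (\<alpha> i * n i) *\<^sub>R urn_expectation r \<alpha> p v (?n i)) =
      (\<Sum>i=1..r. real (\<alpha> i * n i) *\<^sub>R stopped_power r v (?n i)) +
      (\<Sum>i=1..r. real (\<alpha> i * n i) *\<^sub>R (?L (?n i) - ?L n)) + (\<Sum>i=1..r. real (\<alpha> i * n i) *\<^sub>R ?L n)"
    by (simp add: urn_expectation_def scaleR_add_right scaleR_diff_right sum.distrib sum_subtractf)
  also have "\<dots> = (\<Sum>i=1..r. real (\<alpha> i * n i) *\<^sub>R ?L n)"
    using assms sum_integral_urn_density[of r \<alpha> n p v] urn_density_0[of r n \<alpha> p v] by simp
  also have "\<dots> = real (\<Sum>i=1..r. \<alpha> i * n i) *\<^sub>R urn_expectation r \<alpha> p v n"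
    using assms(3) by (simp add: urn_expectation_def stopped_power_def scaleR_sum_left)
  finally show ?thesis by simp
qed

theorem theorem3:
  fixes r :: nat and \<alpha> p n :: "nat \<Rightarrow> nat" and v :: "nat \<Rightarrow> complex"
  assumes "2 \<le> r"
    and "\<And>i. i \<in> {1..r} \<Longrightarrow> 1 \<le> \<alpha> i"
    and "1 \<le> n r"
  shows "urn_pgf r \<alpha> p n v =
    (LINT t:{0..}|lborel.
       urn_g \<alpha> p v r t ^ (n r - 1) * v (r - 1) ^ p r *
       complex_of_real (real (\<alpha> r) * real (n r) * exp (- real (\<alpha> r) * t)) *
       (\<Prod>l = 1..r - 1. urn_f \<alpha> p v l t ^ n l))"
proof -
  interpret unit_urn r \<alpha> "chain_offspring p" "urn_matrix r \<alpha> p" "chain_weight p"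
    using assms(1,2) by (intro unit_urn_chain) auto
  have "urn_pgf r \<alpha> p n v =
      (LINT b|measure_spmf (urn_stopped (urn_matrix r \<alpha> p) r (balls n)).
        (\<Prod>l = 1..r - 1. v l ^ (b l div \<alpha> l)))"
    by (simp add: urn_pgf_def urn_final_units_def balls_def[abs_def] measure_map_spmf_conv_distr
        integral_distr)
  also have "\<dots> = urn_expectation r \<alpha> p v n"
  proof (rule expectation_urn_stopped_eqI)
    have "balls n l div \<alpha> l = n l" if "l \<in> {1..r}" for n l
      using assms(2)[OF that] by (simp add: balls_def)
    then show "(\<Prod>l = 1..r - 1. v l ^ (balls n l div \<alpha> l)) = urn_expectation r \<alpha> p v n"
      if "n r = 0" for n
      using that
      by (auto simp: urn_expectation_def stopped_power_def urn_density_def intro!: prod.cong)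
    show "real (\<Sum>i=1..r. balls n i) *\<^sub>R urn_expectation r \<alpha> p v n =
        (\<Sum>i=1..r. real (balls n i) *\<^sub>R urn_expectation r \<alpha> p v (replace_unit (chain_offspring p) i n))"
      if "n r \<noteq> 0" for n
      unfolding balls_def using assms(1,2) that by (intro urn_expectation_step) auto
  qed
  also have "\<dots> = (LINT t:{0..}|lborel. urn_density r \<alpha> p v n t)"
    using assms(3) by (simp add: urn_expectation_def stopped_power_def)
  finally show ?thesis
    unfolding urn_density_def .
qed

end
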